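(* Let $f_1:\mathbb{R}^d\to\mathbb{R}^m$ and $f_2:\mathbb{R}^m\to\mathbb{R}$ be in $\mathcal{C}^1$, $x_0\in\mathbb{R}^d$, $\bar\Delta>0$, and let $\{\widetilde f_{1,\Delta}\}_{\Delta\in(0,\bar\Delta]}$, $\{\widetilde f_{2,\Delta}\}_{\Delta\in(0,\bar\Delta]}$ be classes of (differentiable) models of $f_1$ and $f_2$. Put $F=f_2\circ f_1$ and $\widetilde F_\Delta=\widetilde f_{2,\Delta}\circ\widetilde f_{1,\Delta}$. Suppose $\{\widetilde f_{1,\Delta}\}_{(0,\bar\Delta]}$ provides order-$\infty$ function accuracy of $f_1$ at $x_0$ with constant $\kappa_1^f(x_0)=0$, and order-$N_1^g$ gradient accuracy of $f_1$ at $x_0$ with constant $\kappa_1^g(x_0)$. Suppose $\{\widetilde f_{2,\Delta}\}_{(0,\bar\Delta]}$ provides order-$\infty$ function accuracy of $f_2$ at $f_1(x_0)$ with constant $\kappa_2^f(f_1(x_0))=0$, and order-$N_2^g$ gradient accuracy of $f_2$ at $f_1(x_0)$ with constant $\kappa_2^g(f_1(x_0))$. Here $N_1^g,N_2^g\ge0$. Let $N_F^g=\min\{N_1^g,N_2^g\}$. Then for every $\Delta\in(0,\bar\Delta]$ $$\|\nabla F(x_0)-\nabla\widetilde F_\Delta(x_0)\|\le K_F^g(x_0)\Delta^{N_F^g},$$ where $$K_F^g(x_0)=\|\nabla f_2(f_1(x_0))\|\kappa_1^g(x_0)\bar\Delta^{N_1^g-N_F^g}+M_{\nabla\widetilde f_1}(x_0)\kappa_2^g(f_1(x_0))\bar\Delta^{N_2^g-N_F^g}.$$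 In particular, $\{\widetilde F_\Delta\}_{(0,\bar\Delta]}$ provides order-$N_F^g$ gradient accuracy of $F$ at $x_0$.
   Context: For a mapping $g:\mathbb{R}^d\to\mathbb{R}^m$, $\nabla g(x)$ denotes its $m\times d$ Jacobian matrix; for a scalar function it denotes the gradient (column) vector; $\nabla f_2(f_1(x_0))$ is the gradient of $f_2$ evaluated at the point $f_1(x_0)$. $\|\cdot\|$ is the Euclidean norm for vectors and the induced operator norm for matrices. A class of models of $f:\mathbb{R}^p\to\mathbb{R}^q$ is a family of mappings $\widetilde f_\Delta:\mathbb{R}^p\to\mathbb{R}^q$ indexed by $\Delta\in(0,\bar\Delta]$; when gradients of models appear the models are understood to be differentiable. Order-$\infty$ function accuracy of $f$ at a point $y$ with constant $0$ means $\widetilde f_\Delta(y)=f(y)$ for all $\Delta\in(0,\bar\Delta]$. For real $N\ge0$ and $\kappa\ge0$, the class provides order-$N$ gradient accuracy of $f$ at $y$ with constant $\kappa$ if $\|\nabla f(y)-\nabla\widetilde f_\Delta(y)\|\le\kappa\Delta^N$ for all $\Delta\in(0,\bar\Delta]$. Without mention of a constant, it is meant that some such $\kappa\ge0$ exists. $M_{\nabla\widetilde f_1}(x_0)$ denotes a number with $\|\nabla\widetilde f_{1,\Delta}(x_0)\|\le M_{\nabla\widetilde f_1}(x_0)$ for all $\Delta\in(0,\bar\Delta]$ (such a bound exists). *)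

theory Defs
  imports "HOL-Analysis.Analysis"
begin

definition continuously_differentiable ::
    "('a::real_normed_vector \<Rightarrow> 'b::real_normed_vector) \<Rightarrow> bool" where
  "continuously_differentiable f \<longleftrightarrow>
     (\<exists>f' :: 'a \<Rightarrow> 'a \<Rightarrow>\<^sub>L 'b.
        (\<forall>x. (f has_derivative blinfun_apply (f' x)) (at x)) \<and> continuous_on UNIV f')"

definition gradient :: "(real^'n \<Rightarrow> real) \<Rightarrow> real^'n \<Rightarrow> real^'n" where
  "gradient f x = (\<chi> i. frechet_derivative f (at x) (axis i 1))"

lemma GDERIV_gradient:
  fixes f :: "real^'n \<Rightarrow> real"
  assumes "f differentiable (at x)"
  shows "GDERIV f x :> gradient f x"
proof -
  have lin: "linear (frechet_derivative f (at x))"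
    using assms by (rule linear_frechet_derivative)
  have "frechet_derivative f (at x) h = h \<bullet> gradient f x" for h
  proof -
    have "frechet_derivative f (at x) h
        = frechet_derivative f (at x) (\<Sum>i\<in>UNIV. h $ i *\<^sub>R axis i 1)"
      using basis_expansion[of h] by (simp add: scalar_mult_eq_scaleR)
    also have "\<dots> = h \<bullet> gradient f x"
      by (simp add: linear_sum[OF lin] linear_scale[OF lin] inner_vec_def gradient_def)
    finally show ?thesis .
  qed
  then have "frechet_derivative f (at x) = (\<lambda>h. h \<bullet> gradient f x)" by blast
  then show ?thesis
    using assms unfolding gderiv_def frechet_derivative_works by simp
qed

text \<open>The library \<open>norm\<close> on matrices is the Frobenius norm, not the one induced by
  the Euclidean norms.\<close>

definition matrix_opnorm :: "real^'n^'m \<Rightarrow> real" where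
  "matrix_opnorm A = onorm (\<lambda>v. A *v v)"

text \<open>A class of models is a function of \<open>\<Delta>\<close>; only its values for \<open>\<Delta> \<in> (0, D]\<close> matter,
  where \<open>D\<close> is the upper bound of the index range.\<close>

text \<open>Function accuracy of order infinity with constant zero.\<close>

definition exact_function_accuracy ::
    "real \<Rightarrow> (real \<Rightarrow> 'a \<Rightarrow> 'b) \<Rightarrow> ('a \<Rightarrow> 'b) \<Rightarrow> 'a \<Rightarrow> bool" where
  "exact_function_accuracy D ft f y \<longleftrightarrow> (\<forall>\<Delta>\<in>{0<..D}. ft \<Delta> y = f y)"

text \<open>Gradient accuracy of order \<open>N\<close> with constant \<open>\<kappa>\<close>. The differentiability clauses
  are required because \<open>frechet_derivative\<close>, hence \<open>jacobian\<close> and \<open>gradient\<close>, is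
  unspecified at points of non-differentiability.\<close>

definition jacobian_accuracy ::
    "real \<Rightarrow> (real \<Rightarrow> real^'p \<Rightarrow> real^'q) \<Rightarrow> (real^'p \<Rightarrow> real^'q) \<Rightarrow> real^'p \<Rightarrow> real \<Rightarrow> real \<Rightarrow> bool"
  where
  "jacobian_accuracy D ft f y N \<kappa> \<longleftrightarrow>
     f differentiable (at y) \<and>
     (\<forall>\<Delta>\<in>{0<..D}. (\<forall>x. ft \<Delta> differentiable (at x)) \<and>
        matrix_opnorm (jacobian f (at y) - jacobian (ft \<Delta>) (at y)) \<le> \<kappa> * \<Delta> powr N)"

definition gradient_accuracy ::
    "real \<Rightarrow> (real \<Rightarrow> real^'p \<Rightarrow> real) \<Rightarrow> (real^'p \<Rightarrow> real) \<Rightarrow> real^'p \<Rightarrow> real \<Rightarrow> real \<Rightarrow> bool"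
  where
  "gradient_accuracy D ft f y N \<kappa> \<longleftrightarrow>
     f differentiable (at y) \<and>
     (\<forall>\<Delta>\<in>{0<..D}. (\<forall>x. ft \<Delta> differentiable (at x)) \<and>
        norm (gradient f y - gradient (ft \<Delta>) y) \<le> \<kappa> * \<Delta> powr N)"

end

theory Submission
  imports Defs
begin

text \<open>Because the models interpolate at \<open>x0\<close> and \<open>f1 x0\<close>, the chain rule gives both gradients as
  products \<open>g J\<close> and \<open>g' J'\<close> of a gradient (row) vector taken at the same point \<open>f1 x0\<close> and a
  Jacobian. The error splits as \<open>g J - g' J' = g (J - J') + (g - g') J'\<close>, and the two
  different powers of \<open>\<Delta> \<le> D\<close> are reduced to the smaller exponent at the cost of powers of \<open>D\<close>.\<close>

lemma norm_matrix_vector_mult_le_opnorm: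
  "norm (A *v x) \<le> matrix_opnorm A * norm x"
  unfolding matrix_opnorm_def by (rule onorm) simp

lemma matrix_opnorm_nonneg: "0 \<le> matrix_opnorm A"
  unfolding matrix_opnorm_def by (rule onorm_pos_le) simp

text \<open>A row vector acts through the transpose, whose induced norm is the same. Pairing
  \<open>v v* A\<close> with itself and moving \<open>A\<close> to the other side of the inner
  product brings in only \<open>A *v _\<close>; Cauchy-Schwarz then applies.\<close>

lemma norm_vector_matrix_mult_le_opnorm:
  fixes A :: "real^'n^'m"
  shows "norm (v v* A) \<le> norm v * matrix_opnorm A"
proof -
  have "norm (v v* A) * norm (v v* A) = v \<bullet> (A *v (v v* A))"
    by (metis dot_lmul_matrix dot_square_norm power2_eq_square)
  also have "\<dots> \<le> norm v * norm (A *v (v v* A))"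
    by (rule norm_cauchy_schwarz)
  also have "\<dots> \<le> norm v * (matrix_opnorm A * norm (v v* A))"
    by (intro mult_left_mono norm_matrix_vector_mult_le_opnorm) simp
  finally show ?thesis
    \<comment> \<open>One factor \<open>norm (v v* A)\<close> cancels unless it vanishes, and then
      the right side is nonnegative.\<close>
    by (cases "norm (v v* A) = 0") (simp_all add: matrix_opnorm_nonneg)
qed

text \<open>By uniqueness of the derivative, the entries of \<open>gradient f x\<close> are the
  products of \<open>g\<close> with the standard basis vectors.\<close>

lemma has_derivative_imp_gradient_eq:
  assumes "(f has_derivative (\<lambda>h. g \<bullet> h)) (at x)"
  shows "gradient f x = g"
  by (simp add: gradient_def vec_eq_iff inner_axis flip: frechet_derivative_at[OF assms])

lemma gradient_compose:
  fixes f :: "real^'n \<Rightarrow> real^'m" and g :: "real^'m \<Rightarrow> real"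
  assumes f: "f differentiable (at x)" and g: "g differentiable (at (f x))"
  shows "gradient (g \<circ> f) x = gradient g (f x) v* jacobian f (at x)"
proof (rule has_derivative_imp_gradient_eq)
  have "(f has_derivative (\<lambda>h. jacobian f (at x) *v h)) (at x)"
    using f by (simp add: jacobian_works)
  from diff_chain_at[OF this GDERIV_gradient[OF g, unfolded gderiv_def]]
  show "(g \<circ> f has_derivative (\<lambda>h. (gradient g (f x) v* jacobian f (at x)) \<bullet> h)) (at x)"
    by (simp add: o_def dot_lmul_matrix inner_commute[of _ "gradient g (f x)"])
qed

text \<open>The mixed term is chosen as \<open>g J'\<close>, so that the factors left over are the
  gradient of the true outer map and the Jacobian of the inner model.\<close>

lemma norm_gradient_compose_diff_le:
  fixes f f' :: "real^'n \<Rightarrow> real^'m" and g g' :: "real^'m \<Rightarrow> real"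
  assumes "f differentiable (at x)" "f' differentiable (at x)"
    and "g differentiable (at (f x))" "g' differentiable (at (f x))"
    and eq: "f' x = f x"
  shows "norm (gradient (g \<circ> f) x - gradient (g' \<circ> f') x)
    \<le> norm (gradient g (f x)) * matrix_opnorm (jacobian f (at x) - jacobian f' (at x))
      + norm (gradient g (f x) - gradient g' (f x)) * matrix_opnorm (jacobian f' (at x))"
proof -
  let ?J = "jacobian f (at x)" and ?J' = "jacobian f' (at x)"
  let ?g = "gradient g (f x)" and ?g' = "gradient g' (f x)"
  have "gradient (g \<circ> f) x - gradient (g' \<circ> f') x = ?g v* ?J - ?g' v* ?J'"
    using assms by (simp add: gradient_compose)
  also have "\<dots> = ?g v* (?J - ?J') + (?g - ?g') v* ?J'"
    by (simp add: vec_eq_iff vector_matrix_mult_def algebra_simps sum_subtractf)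
  finally show ?thesis
    by (metis add_mono norm_triangle_le norm_vector_matrix_mult_le_opnorm)
qed

text \<open>Split off \<open>d powr (N - M)\<close>; its exponent is nonnegative, so it grows when
  \<open>d\<close> is replaced by \<open>D\<close>.\<close>

lemma powr_le_powr_diff_mult_powr:
  fixes d D M N :: real
  assumes "0 < d" "d \<le> D" "M \<le> N"
  shows "d powr N \<le> D powr (N - M) * d powr M"
proof -
  have "d powr N = d powr (N - M) * d powr M"
    by (simp flip: powr_add)
  then show ?thesis
    using assms by (simp add: mult_right_mono powr_mono2)
qed

theorem theorem31:
  fixes f1 :: "real^'d \<Rightarrow> real^'m"
    and f2 :: "real^'m \<Rightarrow> real"
    and f1t :: "real \<Rightarrow> real^'d \<Rightarrow> real^'m"
    and f2t :: "real \<Rightarrow> real^'m \<Rightarrow> real"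
    and F :: "real^'d \<Rightarrow> real"
    and Ft :: "real \<Rightarrow> real^'d \<Rightarrow> real"
    and x0 :: "real^'d"
    and D N1 N2 NF \<kappa>1 \<kappa>2 M1 KF :: real
  assumes "continuously_differentiable f1"
    and "continuously_differentiable f2"
    and "D > 0"
    and "F = f2 \<circ> f1"
    and "Ft = (\<lambda>\<Delta>. f2t \<Delta> \<circ> f1t \<Delta>)"
    and "N1 \<ge> 0" and "N2 \<ge> 0" and "\<kappa>1 \<ge> 0" and "\<kappa>2 \<ge> 0"
    and "exact_function_accuracy D f1t f1 x0"
    and "jacobian_accuracy D f1t f1 x0 N1 \<kappa>1"
    and "exact_function_accuracy D f2t f2 (f1 x0)"
    and "gradient_accuracy D f2t f2 (f1 x0) N2 \<kappa>2"
    and "\<forall>\<Delta>\<in>{0<..D}. matrix_opnorm (jacobian (f1t \<Delta>) (at x0)) \<le> M1"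
    and "NF = min N1 N2"
    and "KF = norm (gradient f2 (f1 x0)) * \<kappa>1 * D powr (N1 - NF)
            + M1 * \<kappa>2 * D powr (N2 - NF)"
  shows "(\<forall>\<Delta>\<in>{0<..D}. norm (gradient F x0 - gradient (Ft \<Delta>) x0) \<le> KF * \<Delta> powr NF) \<and>
         (\<exists>\<kappa>\<ge>0. gradient_accuracy D Ft F x0 NF \<kappa>)"
proof -
  have diff: "f1 differentiable (at x0)" "f2 differentiable (at (f1 x0))"
    using assms(11,13) by (auto simp: jacobian_accuracy_def gradient_accuracy_def)
  have bound: "norm (gradient F x0 - gradient (Ft \<Delta>) x0) \<le> KF * \<Delta> powr NF"
    if \<Delta>: "\<Delta> \<in> {0<..D}" for \<Delta>
  proof -
    let ?J' = "jacobian (f1t \<Delta>) (at x0)"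
    have model: "f1t \<Delta> differentiable (at x0)" "f2t \<Delta> differentiable (at (f1 x0))"
      "f1t \<Delta> x0 = f1 x0"
      "matrix_opnorm (jacobian f1 (at x0) - ?J') \<le> \<kappa>1 * \<Delta> powr N1"
      "norm (gradient f2 (f1 x0) - gradient (f2t \<Delta>) (f1 x0)) \<le> \<kappa>2 * \<Delta> powr N2"
      "matrix_opnorm ?J' \<le> M1"
      using \<Delta> assms(10,11,13,14)
      by (auto simp: exact_function_accuracy_def jacobian_accuracy_def gradient_accuracy_def)
    \<comment> \<open>The sign of \<open>M1\<close> is inherited from the operator norm that it
      bounds; it is needed to multiply an inequality by \<open>M1\<close> below.\<close>
    have M1: "0 \<le> M1"
      using matrix_opnorm_nonneg model(6) by (rule order_trans)
    have "norm (gradient F x0 - gradient (Ft \<Delta>) x0)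
      \<le> norm (gradient f2 (f1 x0)) * matrix_opnorm (jacobian f1 (at x0) - ?J')
        + norm (gradient f2 (f1 x0) - gradient (f2t \<Delta>) (f1 x0)) * matrix_opnorm ?J'"
      unfolding assms(4,5)
      by (rule norm_gradient_compose_diff_le[OF diff(1) model(1) diff(2) model(2,3)])
    also have "\<dots> \<le> norm (gradient f2 (f1 x0)) * (\<kappa>1 * \<Delta> powr N1) + (\<kappa>2 * \<Delta> powr N2) * M1"
      using model assms(9) by (intro add_mono mult_mono matrix_opnorm_nonneg) simp_all
    \<comment> \<open>As \<open>NF\<close> is the minimum, both \<open>N1 - NF\<close> and
      \<open>N2 - NF\<close> are nonnegative.\<close>
    also have "\<dots> \<le> norm (gradient f2 (f1 x0)) * (\<kappa>1 * (D powr (N1 - NF) * \<Delta> powr NF))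
        + (\<kappa>2 * (D powr (N2 - NF) * \<Delta> powr NF)) * M1"
      using \<Delta> M1 assms(8,9,15)
      by (intro add_mono mult_left_mono mult_right_mono powr_le_powr_diff_mult_powr) auto
    also have "\<dots> = KF * \<Delta> powr NF"
      unfolding assms(16) by (simp add: algebra_simps)
    finally show ?thesis .
  qed
  \<comment> \<open>The index \<open>D\<close> itself lies in the range because
    \<open>D > 0\<close>, which gives the sign of \<open>M1\<close> without a fixed
    \<Delta>.\<close>
  have "matrix_opnorm (jacobian (f1t D) (at x0)) \<le> M1"
    using assms(3,14) by auto
  with matrix_opnorm_nonneg have "0 \<le> M1"
    by (rule order_trans)
  then have "0 \<le> KF"
    unfolding assms(16) using assms(8,9) by simp
  \<comment> \<open>The witness is \<open>KF\<close>; beyond the bound, the chain rule supplies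
    differentiability of \<open>F\<close> at \<open>x0\<close> and of each
    \<open>Ft \<Delta>\<close> everywhere.\<close>
  moreover have "gradient_accuracy D Ft F x0 NF KF"
    using bound diff assms(11,13) unfolding gradient_accuracy_def jacobian_accuracy_def assms(4,5)
    by (auto intro!: differentiable_chain_at)
  ultimately show ?thesis
    using bound by blast
qed

end
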